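(* Let $R$ be a commutative ring and let $\mathfrak a\subseteq R$ be an idempotent ideal (i.e., $\mathfrak a^2=\mathfrak a$). Then $\mathfrak a$ is fair, i.e., $\operatorname{Ass}_R(M/\Gamma_{\mathfrak a}(M))=\operatorname{Ass}_R(M)\setminus\operatorname{Var}(\mathfrak a)$ for every $R$-module $M$.
   Context: Rings are commutative with unit (possibly zero). For a ring $R$, an ideal $\mathfrak a\subseteq R$ and an $R$-module $M$: $\operatorname{Var}(\mathfrak a)=\{\mathfrak p\in\operatorname{Spec}(R)\mid\mathfrak a\subseteq\mathfrak p\}$; $\Gamma_{\mathfrak a}(M)=\{x\in M\mid\exists n\in\mathbb N:\mathfrak a^n\subseteq(0:_Rx)\}$ (small $\mathfrak a$-torsion submodule); $\operatorname{Ass}_R(M)=\{\mathfrak p\in\operatorname{Spec}(R)\mid\exists x\in M:\mathfrak p=(0:_Rx)\}$. *)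

theory Defs
  imports "HOL-Algebra.Module" "HOL-Algebra.Ideal_Product"
begin

definition Spec :: "('a, 'c) ring_scheme \<Rightarrow> 'a set set"
  where "Spec R = {\<pp>. primeideal \<pp> R}"

definition Var :: "('a, 'c) ring_scheme \<Rightarrow> 'a set \<Rightarrow> 'a set set"
  where "Var R \<aa> = {\<pp> \<in> Spec R. \<aa> \<subseteq> \<pp>}"

definition annihilator ::
    "('a, 'c) ring_scheme \<Rightarrow> ('a, 'b, 'd) module_scheme \<Rightarrow> 'b \<Rightarrow> 'a set"
  where "annihilator R M x = {r \<in> carrier R. r \<odot>\<^bsub>M\<^esub> x = \<zero>\<^bsub>M\<^esub>}"

definition Ass :: "('a, 'c) ring_scheme \<Rightarrow> ('a, 'b, 'd) module_scheme \<Rightarrow> 'a set set"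
  where "Ass R M = {\<pp> \<in> Spec R. \<exists>x \<in> carrier M. \<pp> = annihilator R M x}"

text \<open>Ideal powers are taken in the multiplicative monoid of ideals, whose unit is the
  unit ideal; in particular the zeroth power of any ideal is the whole ring.\<close>

definition small_torsion ::
    "('a, 'c) ring_scheme \<Rightarrow> 'a set \<Rightarrow> ('a, 'b, 'd) module_scheme \<Rightarrow> 'b set"
  where "small_torsion R \<aa> M =
    {x \<in> carrier M. \<exists>n::nat. \<aa> [^]\<^bsub>ideals_set R\<^esub> n \<subseteq> annihilator R M x}"

text \<open>The record type of modules extends that of rings, but the locale of modules does not
  constrain the fields \<open>mult\<close> and \<open>one\<close>; they are left unspecified here.\<close>

definition quotient_module ::
    "('a, 'b, 'd) module_scheme \<Rightarrow> 'b set \<Rightarrow> ('a, 'b set) module"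
  where "quotient_module M N =
    \<lparr>carrier = a_rcosets\<^bsub>M\<^esub> N, mult = undefined, one = undefined, zero = N,
     add = set_add M, smult = (\<lambda>r C. \<Union>x\<in>C. N +>\<^bsub>M\<^esub> (r \<odot>\<^bsub>M\<^esub> x))\<rparr>"

lemma quotient_module_smult:
  assumes M: "module R M" and N: "submodule N R M"
    and r: "r \<in> carrier R" and x: "x \<in> carrier M"
  shows "r \<odot>\<^bsub>quotient_module M N\<^esub> (N +>\<^bsub>M\<^esub> x) = N +>\<^bsub>M\<^esub> (r \<odot>\<^bsub>M\<^esub> x)"
proof -
  interpret M: module R M by (rule M)
  have N_sub: "subgroup N (add_monoid M)" using N by (rule submodule.axioms)
  have N_carr: "n \<in> carrier M" if "n \<in> N" for n
    using subgroup.subset[OF N_sub] that by auto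
  have eq: "N +>\<^bsub>M\<^esub> (r \<odot>\<^bsub>M\<^esub> y) = N +>\<^bsub>M\<^esub> (r \<odot>\<^bsub>M\<^esub> x)" if y: "y \<in> N +>\<^bsub>M\<^esub> x" for y
  proof -
    obtain n where n: "n \<in> N" "y = n \<oplus>\<^bsub>M\<^esub> x" using y by (auto simp: a_r_coset_def')
    have "r \<odot>\<^bsub>M\<^esub> y = r \<odot>\<^bsub>M\<^esub> n \<oplus>\<^bsub>M\<^esub> r \<odot>\<^bsub>M\<^esub> x"
      using n r x N_carr by (simp add: M.smult_r_distr)
    moreover have "r \<odot>\<^bsub>M\<^esub> n \<in> N" using submodule.smult_closed[OF N r] n by simp
    ultimately have "r \<odot>\<^bsub>M\<^esub> y \<in> N +>\<^bsub>M\<^esub> (r \<odot>\<^bsub>M\<^esub> x)" by (auto simp: a_r_coset_def')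
    then have "r \<odot>\<^bsub>M\<^esub> y \<in> N #>\<^bsub>add_monoid M\<^esub> (r \<odot>\<^bsub>M\<^esub> x)"
      by (simp add: a_r_coset_def)
    from M.add.repr_independence[OF this _ N_sub] r x show ?thesis
      by (simp add: a_r_coset_def)
  qed
  have "x \<in> N +>\<^bsub>M\<^esub> x" using M.add.rcos_self[OF x N_sub] by (simp add: a_r_coset_def)
  then have "(\<Union>y\<in>N +>\<^bsub>M\<^esub> x. N +>\<^bsub>M\<^esub> (r \<odot>\<^bsub>M\<^esub> y)) = N +>\<^bsub>M\<^esub> (r \<odot>\<^bsub>M\<^esub> x)"
    using eq by blast
  then show ?thesis by (simp add: quotient_module_def)
qed

text \<open>Fairness quantifies over all modules. A quantifier inside a definition cannot range over
  types, so the record type of the modules is passed as a parameter; a statement that leaves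
  the type variables in this parameter free covers modules over arbitrary types.\<close>

definition fair :: "('a, 'b, 'd) module_scheme itself \<Rightarrow> ('a, 'c) ring_scheme \<Rightarrow> 'a set \<Rightarrow> bool"
  where "fair T R \<aa> \<longleftrightarrow> (\<forall>M :: ('a, 'b, 'd) module_scheme. module R M \<longrightarrow>
    Ass R (quotient_module M (small_torsion R \<aa> M)) = Ass R M - Var R \<aa>)"

end

theory Submission
  imports Defs
begin

text \<open>
  All positive powers of an idempotent ideal \<open>\<aa>\<close> equal \<open>\<aa>\<close>, so \<open>\<Gamma>\<^sub>\<aa>(M)\<close> is simply the
  set of elements killed by \<open>\<aa>\<close>
  (\<open>small_torsion_idempotent\<close>). Hence the annihilator of the class of \<open>x\<close> in the quotient
  is \<open>{r. \<aa> \<subseteq> ann (r x)}\<close>, a transporter that can be compared with \<open>ann x\<close>.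

  If \<open>\<pp> = ann x\<close> is prime and some \<open>s \<in> \<aa>\<close> lies outside \<open>\<pp>\<close>, then \<open>s r x = 0\<close> already forces
  \<open>r \<in> \<pp>\<close>, so that the class of \<open>x\<close> still has annihilator \<open>\<pp>\<close>. Conversely, let \<open>\<pp>\<close> be the
  annihilator of the class of \<open>x\<close>. If \<open>\<aa>\<close> were contained in \<open>\<pp>\<close>, then \<open>\<aa> \<aa> x = 0\<close>, so
  \<open>\<aa> x = 0\<close> by idempotence; the class of \<open>x\<close> would vanish and \<open>\<pp>\<close> would be the whole ring. So
  there is \<open>s \<in> \<aa> - \<pp>\<close>, and multiplying by \<open>s\<close> lifts the class to an
  element \<open>s x\<close> of \<open>M\<close> itself with annihilator \<open>\<pp>\<close>.
\<close>

context module
begin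

lemma smult_left_commute:
  assumes "a \<in> carrier R" and "b \<in> carrier R" and "x \<in> carrier M"
  shows "a \<odot>\<^bsub>M\<^esub> (b \<odot>\<^bsub>M\<^esub> x) = b \<odot>\<^bsub>M\<^esub> (a \<odot>\<^bsub>M\<^esub> x)"
  using assms R.m_comm[of a b] smult_assoc1[of a b x] smult_assoc1[of b a x] by simp

lemma annihilator_quotient_module:
  assumes N: "submodule N R M" and x: "x \<in> carrier M"
  shows "annihilator R (quotient_module M N) (N +>\<^bsub>M\<^esub> x) = {r \<in> carrier R. r \<odot>\<^bsub>M\<^esub> x \<in> N}"
proof -
  have sub: "subgroup N (add_monoid M)" using N by (rule submodule.axioms)
  have "N +>\<^bsub>M\<^esub> y = N \<longleftrightarrow> y \<in> N" if "y \<in> carrier M" for y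
    using M.a_coset_join1[OF _ that sub] M.a_coset_join2[OF that sub] by blast
  moreover have "r \<odot>\<^bsub>quotient_module M N\<^esub> (N +>\<^bsub>M\<^esub> x) = N +>\<^bsub>M\<^esub> (r \<odot>\<^bsub>M\<^esub> x)" if "r \<in> carrier R" for r
    using quotient_module_smult[OF module_axioms N that x] .
  moreover have "\<zero>\<^bsub>quotient_module M N\<^esub> = N"
    by (simp add: quotient_module_def)
  ultimately show ?thesis
    unfolding annihilator_def using x by auto
qed

text \<open>An annihilator is closed under addition, so it suffices to test the generating products
  of a product of ideals.\<close>

lemma ideal_prod_subset_annihilator:
  assumes I: "I \<subseteq> carrier R" and J: "J \<subseteq> carrier R" and x: "x \<in> carrier M"
    and kill: "\<And>j. j \<in> J \<Longrightarrow> I \<subseteq> annihilator R M (j \<odot>\<^bsub>M\<^esub> x)"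
  shows "ideal_prod R I J \<subseteq> annihilator R M x"
proof
  fix r assume "r \<in> ideal_prod R I J"
  then show "r \<in> annihilator R M x"
  proof induction
    case (prod i j)
    then have "i \<in> carrier R" "j \<in> carrier R" "i \<odot>\<^bsub>M\<^esub> (j \<odot>\<^bsub>M\<^esub> x) = \<zero>\<^bsub>M\<^esub>"
      using I J kill[of j] by (auto simp: annihilator_def)
    then show ?case using x by (simp add: annihilator_def smult_assoc1)
  next
    case (sum s t)
    then show ?case using x by (simp add: annihilator_def smult_l_distr)
  qed
qed

lemma submodule_annihilated:
  assumes I: "I \<subseteq> carrier R"
  shows "submodule {x \<in> carrier M. I \<subseteq> annihilator R M x} R M"
proof (rule submoduleI)
  fix r x assume r: "r \<in> carrier R" and x: "x \<in> {x \<in> carrier M. I \<subseteq> annihilator R M x}"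
  have "i \<odot>\<^bsub>M\<^esub> (r \<odot>\<^bsub>M\<^esub> x) = \<zero>\<^bsub>M\<^esub>" if "i \<in> I" for i
  proof -
    have i: "i \<in> carrier R" "i \<odot>\<^bsub>M\<^esub> x = \<zero>\<^bsub>M\<^esub>" using that x by (auto simp: annihilator_def)
    then show ?thesis using r x smult_left_commute[of i r x] by simp
  qed
  then show "r \<odot>\<^bsub>M\<^esub> x \<in> {x \<in> carrier M. I \<subseteq> annihilator R M x}"
    using I r x by (auto simp: annihilator_def)
qed (use I in \<open>auto simp: annihilator_def smult_r_distr smult_r_minus subset_iff\<close>)

end

lemma (in cring) ideal_pow_idempotent:
  assumes "ideal I R" and "ideal_prod R I I = I"
  shows "I [^]\<^bsub>ideals_set R\<^esub> Suc n = I"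
proof (induction n)
  case 0
  interpret ideals: comm_monoid "ideals_set R" by (rule ideals_set_is_comm_monoid)
  have "I \<in> carrier (ideals_set R)" using assms(1) by (simp add: ideals_set_def)
  then show ?case by simp
next
  case (Suc n)
  have "I [^]\<^bsub>ideals_set R\<^esub> Suc (Suc n) = ideal_prod R (I [^]\<^bsub>ideals_set R\<^esub> Suc n) I"
    by (simp add: ideals_set_def nat_pow_def)
  then show ?case using Suc assms(2) by simp
qed

context module
begin

lemma small_torsion_idempotent:
  assumes I: "ideal I R" and idem: "ideal_prod R I I = I"
  shows "small_torsion R I M = {x \<in> carrier M. I \<subseteq> annihilator R M x}"
proof -
  have "(\<exists>n::nat. I [^]\<^bsub>ideals_set R\<^esub> n \<subseteq> A) \<longleftrightarrow> I \<subseteq> A" for A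
  proof
    assume "\<exists>n::nat. I [^]\<^bsub>ideals_set R\<^esub> n \<subseteq> A"
    then obtain n :: nat where n: "I [^]\<^bsub>ideals_set R\<^esub> n \<subseteq> A" by blast
    show "I \<subseteq> A"
    proof (cases n)
      case 0
      \<comment> \<open>the zeroth power is the unit ideal, which contains \<open>I\<close>\<close>
      then have "carrier R \<subseteq> A" using n by (simp add: nat_pow_def ideals_set_def)
      then show ?thesis using ideal.Icarr[OF I] by blast
    next
      case (Suc m)
      then show ?thesis using n R.ideal_pow_idempotent[OF I idem] by simp
    qed
  next
    assume "I \<subseteq> A"
    then show "\<exists>n::nat. I [^]\<^bsub>ideals_set R\<^esub> n \<subseteq> A"
      using R.ideal_pow_idempotent[OF I idem] by (metis (no_types))
  qed
  then show ?thesis by (simp add: small_torsion_def)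
qed

text \<open>This is fairness at the single module \<open>M\<close>; the two inclusions are the two passages between
  annihilators of \<open>x\<close>, of its class and of \<open>s x\<close> with \<open>s \<in> I - P\<close>.\<close>

lemma Ass_quotient_small_torsion:
  assumes I: "ideal I R" and idem: "ideal_prod R I I = I"
  shows "Ass R (quotient_module M (small_torsion R I M)) = Ass R M - Var R I"
proof -
  define N where "N = small_torsion R I M"
  have Icarr: "I \<subseteq> carrier R" using ideal.Icarr[OF I] by blast
  have N_eq: "N = {x \<in> carrier M. I \<subseteq> annihilator R M x}"
    unfolding N_def by (rule small_torsion_idempotent[OF I idem])
  have N: "submodule N R M" unfolding N_eq by (rule submodule_annihilated[OF Icarr])
  have mem_N: "y \<in> N \<longleftrightarrow> (\<forall>i\<in>I. i \<odot>\<^bsub>M\<^esub> y = \<zero>\<^bsub>M\<^esub>)" if "y \<in> carrier M" for y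
    using that Icarr by (auto simp: N_eq annihilator_def)
  have ann_class: "annihilator R (quotient_module M N) (N +>\<^bsub>M\<^esub> x) = {r \<in> carrier R. r \<odot>\<^bsub>M\<^esub> x \<in> N}"
    if "x \<in> carrier M" for x
    using annihilator_quotient_module[OF N that] .
  have classes: "carrier (quotient_module M N) = {N +>\<^bsub>M\<^esub> x | x. x \<in> carrier M}"
    by (auto simp: quotient_module_def A_RCOSETS_def')

  have "P \<in> Ass R M - Var R I" if P: "P \<in> Ass R (quotient_module M N)" for P
  proof -
    have prime: "primeideal P R" using P by (simp add: Ass_def Spec_def)
    obtain x where x: "x \<in> carrier M" and P_eq: "P = {r \<in> carrier R. r \<odot>\<^bsub>M\<^esub> x \<in> N}"
    proof -
      obtain C where "C \<in> carrier (quotient_module M N)" "P = annihilator R (quotient_module M N) C"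
        using P unfolding Ass_def by blast
      then show thesis using that ann_class unfolding classes by blast
    qed
    have "\<not> I \<subseteq> P"
    proof
      assume "I \<subseteq> P"
      then have "I \<subseteq> annihilator R M (j \<odot>\<^bsub>M\<^esub> x)" if "j \<in> I" for j
        using that \<open>I \<subseteq> P\<close> unfolding P_eq N_eq by blast
      then have "I \<subseteq> annihilator R M x"
        using ideal_prod_subset_annihilator[OF Icarr Icarr x] idem by simp
      then have "\<one> \<in> P" using x by (simp add: P_eq N_eq)
      then show False using primeideal.I_notcarr[OF prime] ideal.one_imp_carrier[OF primeideal.axioms(1)[OF prime]]
        by blast
    qed
    then obtain s where s: "s \<in> I" "s \<notin> P" by blast
    have s_carr: "s \<in> carrier R" using s Icarr by blast
    have "P = annihilator R M (s \<odot>\<^bsub>M\<^esub> x)"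
    proof
      show "P \<subseteq> annihilator R M (s \<odot>\<^bsub>M\<^esub> x)"
        using s x s_carr smult_left_commute[OF _ s_carr x] by (auto simp: P_eq mem_N annihilator_def)
      show "annihilator R M (s \<odot>\<^bsub>M\<^esub> x) \<subseteq> P"
      proof
        fix r assume "r \<in> annihilator R M (s \<odot>\<^bsub>M\<^esub> x)"
        then have r: "r \<in> carrier R" and "r \<odot>\<^bsub>M\<^esub> (s \<odot>\<^bsub>M\<^esub> x) = \<zero>\<^bsub>M\<^esub>"
          by (auto simp: annihilator_def)
        then have "(r \<otimes> s) \<odot>\<^bsub>M\<^esub> x = \<zero>\<^bsub>M\<^esub>" using s_carr x by (simp add: smult_assoc1)
        then have "r \<otimes> s \<in> P"
          using r s_carr Icarr by (auto simp: P_eq mem_N)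
        then show "r \<in> P" using primeideal.I_prime[OF prime] r s_carr s(2) by blast
      qed
    qed
    then show ?thesis
      using prime x s_carr \<open>\<not> I \<subseteq> P\<close> by (auto simp: Ass_def Spec_def Var_def)
  qed
  moreover have "P \<in> Ass R (quotient_module M N)" if P: "P \<in> Ass R M - Var R I" for P
  proof -
    have prime: "primeideal P R" using P by (simp add: Ass_def Spec_def)
    obtain x where x: "x \<in> carrier M" and P_eq: "P = annihilator R M x"
      using P by (auto simp: Ass_def)
    obtain s where s: "s \<in> I" "s \<notin> P" using P by (auto simp: Ass_def Var_def)
    have s_carr: "s \<in> carrier R" using s Icarr by blast
    have "r \<odot>\<^bsub>M\<^esub> x \<in> N \<longleftrightarrow> r \<in> P" if r: "r \<in> carrier R" for r
    proof
      assume "r \<odot>\<^bsub>M\<^esub> x \<in> N"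
      then have "s \<odot>\<^bsub>M\<^esub> (r \<odot>\<^bsub>M\<^esub> x) = \<zero>\<^bsub>M\<^esub>" using s r x by (simp add: mem_N)
      then have "s \<otimes> r \<in> P" using s_carr r x by (simp add: P_eq annihilator_def smult_assoc1)
      then show "r \<in> P" using primeideal.I_prime[OF prime] r s_carr s(2) by blast
    next
      assume "r \<in> P"
      then show "r \<odot>\<^bsub>M\<^esub> x \<in> N" using Icarr by (auto simp: P_eq annihilator_def mem_N)
    qed
    moreover have "P \<subseteq> carrier R" unfolding P_eq annihilator_def by blast
    ultimately have "P = annihilator R (quotient_module M N) (N +>\<^bsub>M\<^esub> x)"
      unfolding ann_class[OF x] by blast
    then show ?thesis
      using prime x by (auto simp: Ass_def Spec_def classes)
  qed
  ultimately show ?thesis unfolding N_def by blast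
qed

end

theorem mainTheorem7:
  fixes R :: "('a, 'c) ring_scheme" and \<aa> :: "'a set"
  assumes "cring R"
    and "ideal \<aa> R"
    and "ideal_prod R \<aa> \<aa> = \<aa>"
  shows "fair TYPE(('a, 'b, 'd) module_scheme) R \<aa>"
  unfolding fair_def by (intro allI impI module.Ass_quotient_small_torsion assms(2,3))

end
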